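(* Let $n,k$ be integers with $1\le k\le n-1$ and let $\sigma\in S_n$. Then $\sigma$ is $k$-prolific in $K_n$ if and only if $br(\sigma)\ge k+3$.
   Context: $S_n$ is the set of permutations of $[n]=\{1,\dots,n\}$, written in one-line notation $\sigma=[\sigma_1,\dots,\sigma_n]$. A king permutation of order $n$ is $\sigma\in S_n$ with $|\sigma_{i+1}-\sigma_i|>1$ for all $1\le i\le n-1$; $K_n$ is the set of king permutations of order $n$ (so $K_1=S_1$, $K_2=K_3=\emptyset$). For $i,j\in[n]$ let $d_\sigma(i,j)=|i-j|+|\sigma_i-\sigma_j|$. The breadth of $\sigma$ (for $n\ge 2$) is $br(\sigma)=\min_{i,j\in[n],\,i\neq j} d_\sigma(i,j)$. The pattern formed by a subset of the entries of $\sigma$ of size $m$ is the permutation in $S_m$ that is order-isomorphic to the subsequence of $[\sigma_1,\dots,\sigma_n]$ consisting of those entries. A permutation $\sigma\in S_n$ is called $k$-prolific in $K_n$ if $\sigma\in K_n$ and each $(n-k)$-subset of the entries of $\sigma$ forms a unique pattern in $K_{n-k}$; that is, the pattern formed by every $(n-k)$-subset of the entries belongs to $K_{n-k}$, and distinct $(n-k)$-subsets form distinct patterns. *)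

theory Defs
  imports "HOL-Combinatorics.Permutations"
begin

text \<open>Elements of \<open>S\<^sub>n\<close> are the functions \<open>\<sigma> :: nat \<Rightarrow> nat\<close> with \<open>\<sigma> permutes {1..n}\<close>, the
  one-line notation being \<open>[\<sigma> 1, \<dots>, \<sigma> n]\<close>. Such a function is the identity outside \<open>{1..n}\<close>,
  so equality of functions is equality of permutations.\<close>

definition kings :: "nat \<Rightarrow> (nat \<Rightarrow> nat) set" where
  "kings n = {\<sigma>. \<sigma> permutes {1..n} \<and> (\<forall>i\<in>{1..<n}. \<bar>int (\<sigma> (i + 1)) - int (\<sigma> i)\<bar> > 1)}"

definition entry_dist :: "(nat \<Rightarrow> nat) \<Rightarrow> nat \<Rightarrow> nat \<Rightarrow> int" where
  "entry_dist \<sigma> i j = \<bar>int i - int j\<bar> + \<bar>int (\<sigma> i) - int (\<sigma> j)\<bar>"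

text \<open>Only meaningful for \<open>n \<ge> 2\<close>; otherwise the set is empty.\<close>

definition breadth :: "nat \<Rightarrow> (nat \<Rightarrow> nat) \<Rightarrow> int" where
  "breadth n \<sigma> = Min {entry_dist \<sigma> i j | i j. i \<in> {1..n} \<and> j \<in> {1..n} \<and> i \<noteq> j}"

text \<open>A set of entries of \<open>\<sigma>\<close> is given by the set \<open>A\<close> of their positions. \<open>nth_pos A i\<close> is the
  \<open>i\<close>-th smallest element of \<open>A\<close>, counting from 1, so the subsequence formed by the entries is
  \<open>\<sigma> (nth_pos A 1), \<dots>, \<sigma> (nth_pos A (card A))\<close>.\<close>

definition nth_pos :: "nat set \<Rightarrow> nat \<Rightarrow> nat" where
  "nth_pos A i = sorted_list_of_set A ! (i - 1)"

definition is_pattern :: "(nat \<Rightarrow> nat) \<Rightarrow> nat set \<Rightarrow> (nat \<Rightarrow> nat) \<Rightarrow> bool" where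
  "is_pattern \<sigma> A \<pi> \<longleftrightarrow> \<pi> permutes {1..card A} \<and>
     (\<forall>i\<in>{1..card A}. \<forall>j\<in>{1..card A}.
        \<pi> i < \<pi> j \<longleftrightarrow> \<sigma> (nth_pos A i) < \<sigma> (nth_pos A j))"

definition pattern_of :: "(nat \<Rightarrow> nat) \<Rightarrow> nat set \<Rightarrow> (nat \<Rightarrow> nat)" where
  "pattern_of \<sigma> A = (THE \<pi>. is_pattern \<sigma> A \<pi>)"

lemma bij_betw_nth_pos:
  assumes "finite A"
  shows "bij_betw (nth_pos A) {1..card A} A"
proof -
  have "bij_betw ((!) (sorted_list_of_set A)) {..<card A} A"
    using assms by (intro bij_betw_nth) auto
  moreover have "bij_betw (\<lambda>i. i - 1) {1..card A} {..<card A}"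
    by (rule bij_betwI[where g = Suc]) auto
  ultimately show ?thesis
    using bij_betw_trans[of "\<lambda>i. i - 1" "{1..card A}" "{..<card A}" "(!) (sorted_list_of_set A)" A]
    by (simp add: nth_pos_def[abs_def] comp_def)
qed

lemma order_determines_rank:
  fixes \<pi> :: "nat \<Rightarrow> nat"
  assumes "\<pi> permutes {1..m}" "i \<in> {1..m}"
  shows "\<pi> i = Suc (card {j \<in> {1..m}. \<pi> j < \<pi> i})"
proof -
  have inj: "inj_on \<pi> {j \<in> {1..m}. \<pi> j < \<pi> i}"
    using permutes_inj[OF assms(1)] by (auto simp: inj_on_def)
  have i: "\<pi> i \<in> {1..m}" using permutes_in_image[OF assms(1), of i] assms(2) by blast
  have "\<pi> ` {j \<in> {1..m}. \<pi> j < \<pi> i} = {1..<\<pi> i}"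
  proof (intro equalityI subsetI)
    fix y assume "y \<in> \<pi> ` {j \<in> {1..m}. \<pi> j < \<pi> i}"
    then show "y \<in> {1..<\<pi> i}"
      using permutes_in_image[OF assms(1)] by force
  next
    fix y assume y: "y \<in> {1..<\<pi> i}"
    then have "y \<in> {1..m}" using i by auto
    then obtain j where "j \<in> {1..m}" "y = \<pi> j"
      using permutes_image[OF assms(1)] by blast
    then show "y \<in> \<pi> ` {j \<in> {1..m}. \<pi> j < \<pi> i}" using y by auto
  qed
  then have "card {j \<in> {1..m}. \<pi> j < \<pi> i} = card {1..<\<pi> i}"
    using card_image[OF inj] by simp
  then show ?thesis using i by simp
qed

lemma is_pattern_unique:
  assumes "is_pattern \<sigma> A \<pi>" "is_pattern \<sigma> A \<rho>"
  shows "\<pi> = \<rho>"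
proof
  fix i
  have p: "\<pi> permutes {1..card A}" "\<rho> permutes {1..card A}"
    using assms by (auto simp: is_pattern_def)
  show "\<pi> i = \<rho> i"
  proof (cases "i \<in> {1..card A}")
    case True
    then have "{j \<in> {1..card A}. \<pi> j < \<pi> i} = {j \<in> {1..card A}. \<rho> j < \<rho> i}"
      using assms unfolding is_pattern_def by blast
    then show ?thesis
      using order_determines_rank[OF p(1) True] order_determines_rank[OF p(2) True] by simp
  next
    case False
    then show ?thesis using p by (simp add: permutes_def)
  qed
qed

lemma is_pattern_exists:
  assumes A: "finite A" and inj: "inj_on \<sigma> A"
  shows "\<exists>\<pi>. is_pattern \<sigma> A \<pi>"
proof -
  define m where "m = card A"
  define f where "f = (\<lambda>i. \<sigma> (nth_pos A i))"
  define \<pi> where "\<pi> = (\<lambda>i. if i \<in> {1..m} then card {j \<in> {1..m}. f j \<le> f i} else i)"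
  have "inj_on (nth_pos A) {1..m}" "nth_pos A ` {1..m} = A"
    using bij_betw_nth_pos[OF A] by (auto simp: bij_betw_def m_def)
  then have injf: "inj_on f {1..m}"
    using inj comp_inj_on[of "nth_pos A" "{1..m}" \<sigma>] by (simp add: f_def comp_def)
  have mono: "\<pi> i < \<pi> j" if "i \<in> {1..m}" "j \<in> {1..m}" "f i < f j" for i j
  proof -
    have "{k \<in> {1..m}. f k \<le> f i} \<subset> {k \<in> {1..m}. f k \<le> f j}"
    proof (rule psubsetI)
      show "{k \<in> {1..m}. f k \<le> f i} \<subseteq> {k \<in> {1..m}. f k \<le> f j}" using that by auto
      have "j \<in> {k \<in> {1..m}. f k \<le> f j}" "j \<notin> {k \<in> {1..m}. f k \<le> f i}" using that by auto
      then show "{k \<in> {1..m}. f k \<le> f i} \<noteq> {k \<in> {1..m}. f k \<le> f j}" by blast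
    qed
    then show ?thesis using that psubset_card_mono[of "{k \<in> {1..m}. f k \<le> f j}"]
      by (simp add: \<pi>_def)
  qed
  have iff: "\<pi> i < \<pi> j \<longleftrightarrow> f i < f j" if "i \<in> {1..m}" "j \<in> {1..m}" for i j
  proof (cases "f i" "f j" rule: linorder_cases)
    case less
    then show ?thesis using mono[OF that] by simp
  next
    case equal
    then have "i = j" using inj_onD[OF injf _ that] by simp
    then show ?thesis by simp
  next
    case greater
    then show ?thesis using mono[OF that(2,1)] by simp
  qed
  have "inj_on \<pi> {1..m}"
  proof (rule inj_onI)
    fix i j assume ij: "i \<in> {1..m}" "j \<in> {1..m}" and "\<pi> i = \<pi> j"
    then have "\<not> f i < f j" "\<not> f j < f i" using mono[OF ij] mono[OF ij(2,1)] by auto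
    then show "i = j" using inj_onD[OF injf _ ij] by simp
  qed
  moreover have "\<pi> ` {1..m} \<subseteq> {1..m}"
  proof
    fix y assume "y \<in> \<pi> ` {1..m}"
    then obtain i where i: "i \<in> {1..m}" "y = card {j \<in> {1..m}. f j \<le> f i}"
      by (auto simp: \<pi>_def)
    have "card {j \<in> {1..m}. f j \<le> f i} \<le> card {1..m}" by (intro card_mono) auto
    moreover have "card {j \<in> {1..m}. f j \<le> f i} > 0" using i by (subst card_gt_0_iff) auto
    ultimately show "y \<in> {1..m}" using i by simp
  qed
  ultimately have "bij_betw \<pi> {1..m} {1..m}"
    by (simp add: bij_betw_def endo_inj_surj)
  then have "\<pi> permutes {1..m}"
    by (rule bij_imp_permutes) (auto simp: \<pi>_def)
  then have "is_pattern \<sigma> A \<pi>"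
    using iff by (simp add: is_pattern_def f_def m_def)
  then show ?thesis by (intro exI[where x = \<pi>])
qed

lemma is_pattern_pattern_of:
  assumes "finite A" "inj_on \<sigma> A"
  shows "is_pattern \<sigma> A (pattern_of \<sigma> A)"
proof -
  obtain \<pi> where \<pi>: "is_pattern \<sigma> A \<pi>"
    using is_pattern_exists[OF assms] by (elim exE)
  show ?thesis
    unfolding pattern_of_def
  proof (rule theI[where P = "is_pattern \<sigma> A"])
    show "is_pattern \<sigma> A \<pi>" by (rule \<pi>)
    show "\<rho> = \<pi>" if "is_pattern \<sigma> A \<rho>" for \<rho>
      by (rule is_pattern_unique[OF that \<pi>])
  qed
qed

definition prolific_in_kings :: "nat \<Rightarrow> nat \<Rightarrow> (nat \<Rightarrow> nat) \<Rightarrow> bool" where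
  "prolific_in_kings k n \<sigma> \<longleftrightarrow>
     \<sigma> \<in> kings n \<and>
     (\<forall>A. A \<subseteq> {1..n} \<and> card A = n - k \<longrightarrow> pattern_of \<sigma> A \<in> kings (n - k)) \<and>
     (\<forall>A B. A \<subseteq> {1..n} \<and> card A = n - k \<and> B \<subseteq> {1..n} \<and> card B = n - k \<and> A \<noteq> B \<longrightarrow>
        pattern_of \<sigma> A \<noteq> pattern_of \<sigma> B)"

end

theory Submission
  imports Defs
begin

text \<open>
  Both halves of the theorem are about the set of entries lying strictly between two given entries
  \<open>p\<close> and \<open>q\<close> in position or in value. It has at most \<open>d(p, q) - 2\<close> elements, with equality exactly
  when no entry is strictly between in both senses; passing to an entry that is, and so closer to
  \<open>p\<close>, shows that breadth at least \<open>k + 3\<close> makes all these sets have more than \<open>k\<close> elements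
  (\<open>card_between_le\<close>, \<open>card_between_ge\<close>). Two chosen entries become neighbours in
  both position and value of the pattern iff no entry between them is chosen
  (\<open>pattern_close_iff\<close>). Hence if the breadth is at least \<open>k + 3\<close>, deleting \<open>k\<close> entries leaves a king
  permutation. If it is smaller, some pair can be made adjacent by deleting \<open>k\<close> entries; this needs
  \<open>n - k \<ge> 2\<close>, but for \<open>n - k = 1\<close> all patterns coincide and \<open>\<sigma>\<close> is not prolific either.

  What remains is that large breadth makes the patterns distinct. If \<open>A\<close> and \<open>B\<close> have the same
  pattern, there is a bijection \<open>f\<close> from \<open>A\<close> onto \<open>B\<close> that preserves the order of positions and the
  order of values, and it has to be the identity. Follow the chains \<open>u, f u, f (f u), \<dots>\<close>. In each
  coordinate a chain moves monotonically. If \<open>m\<close> moves up in one coordinate, then a chain of more than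
  one point through a point with that coordinate strictly between \<open>m\<close> and \<open>f m\<close> moves up as well, and
  each chain has at most one such point. As every chain starts at one of the \<open>k\<close> points outside \<open>B\<close>, a set of more
  than \<open>k\<close> points covered by a band of positions and a band of values contains two points of one
  chain, one in each band, and the chain moves up in both coordinates (\<open>crowded_bands\<close>).

  After reversing coordinates, assume that some point moves north-east, that is, up in both
  coordinates. The bands from \<open>m\<close> to \<open>f m\<close> are crowded for every such \<open>m\<close>, and the chain found
  there provides a north-east moving point that is to the south-east of \<open>m\<close> within the band of positions,
  or to the north-west of \<open>m\<close> within the band of values (\<open>north_east_sees\<close>). The minimal north-east
  moving points form a staircase descending to the right. Its first point can only see towards the
  south-east and its last only towards the north-west, so there are two consecutive points \<open>p\<close>, \<open>q\<close> that
  see each other. The points between \<open>p\<close> and \<open>q\<close> are then covered by the band of positions of \<open>p\<close> and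
  the band of values of \<open>q\<close>; a chain found there would contain a north-east moving point both to the left
  of \<open>q\<close> and below \<open>p\<close>, and thus a minimal one there, although every step to the left of \<open>q\<close> is at
  least as high as \<open>p\<close>.
\<close>

section \<open>Maps preserving one coordinate\<close>

definition steps :: "'a set \<Rightarrow> ('a \<Rightarrow> 'a) \<Rightarrow> ('a \<times> 'a) set" where
  "steps A f = {(a, f a) | a. a \<in> A}"

lemma steps_iff [simp]: "(a, b) \<in> steps A f \<longleftrightarrow> a \<in> A \<and> b = f a"
  by (auto simp: steps_def)

lemma steps_linear:
  assumes "(s, u) \<in> (steps A f)\<^sup>*" "(s, v) \<in> (steps A f)\<^sup>*" "u \<noteq> v"
  shows "(u, v) \<in> (steps A f)\<^sup>+ \<or> (v, u) \<in> (steps A f)\<^sup>+"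
proof -
  have "single_valued (steps A f)" by (auto simp: single_valued_def)
  from single_valued_confluent[OF this assms(1,2)] assms(3) show ?thesis
    by (auto simp: rtrancl_eq_or_trancl)
qed

definition band :: "'a set \<Rightarrow> ('a \<Rightarrow> 'a) \<Rightarrow> ('a \<Rightarrow> int) \<Rightarrow> 'a \<Rightarrow> 'a set" where
  "band P f Z m = {u \<in> P. Z m < Z u \<and> Z u < Z (f m)}"

locale coordinate_preserving =
  fixes P A :: "'a set" and f :: "'a \<Rightarrow> 'a" and Z :: "'a \<Rightarrow> int"
  assumes finite_points: "finite P"
    and domain: "A \<subseteq> P"
    and range: "f ` A \<subseteq> P"
    and inj_coordinate: "inj_on Z P"
    and preserves: "\<And>a b. a \<in> A \<Longrightarrow> b \<in> A \<Longrightarrow> Z (f a) < Z (f b) \<longleftrightarrow> Z a < Z b"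
begin

lemma reorient:
  assumes "s = 1 \<or> s = -1"
  shows "coordinate_preserving P A f (\<lambda>u. s * Z u)"
  using assms finite_points domain range inj_coordinate preserves
  by unfold_locales (auto simp: inj_on_def)

text \<open>A chain cannot turn around: \<open>a\<close> rises iff its image does, because \<open>f\<close> preserves the order of
  \<open>a\<close> and \<open>f a\<close>.\<close>

lemma rises_before:
  assumes "(a, w) \<in> (steps A f)\<^sup>*" "w \<in> A" "Z w < Z (f w)"
  shows "a \<in> A \<and> Z a < Z (f a)"
  using assms
proof (induction rule: converse_rtrancl_induct)
  case (step a b)
  then show ?case using preserves[of a "f a"] by simp
qed simp

lemma rises_after:
  assumes "(a, w) \<in> (steps A f)\<^sup>+" "Z a < Z (f a)"
  shows "Z (f a) \<le> Z w"
  using assms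
proof (induction rule: trancl_induct)
  case (step b c)
  have "a \<in> A" using step.hyps(1) by (meson steps_iff tranclD)
  then show ?case using step preserves[of a b] by simp
qed simp

text \<open>Going backwards from a point that was reached by rising, the coordinate keeps falling, so by
  finiteness the chain has a first point, which is outside the image of \<open>f\<close>. A fixed point has no
  start; the hypothesis excludes it.\<close>

lemma rising_has_start:
  assumes "u \<in> P" "\<And>w. w \<in> A \<Longrightarrow> u = f w \<Longrightarrow> Z w < Z u"
  shows "\<exists>s \<in> P - f ` A. (s, u) \<in> (steps A f)\<^sup>*"
  using assms
proof (induction "card {v \<in> P. Z v < Z u}" arbitrary: u rule: less_induct)
  case less
  show ?case
  proof (cases "u \<in> f ` A")
    case True
    then obtain w where w: "w \<in> A" "u = f w" by blast
    have wu: "Z w < Z u" using less.prems(2) w by blast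
    have wP: "w \<in> P" using w domain by blast
    have "{v \<in> P. Z v < Z w} \<subset> {v \<in> P. Z v < Z u}" using wu wP by fastforce
    then have "card {v \<in> P. Z v < Z w} < card {v \<in> P. Z v < Z u}"
      using finite_points by (intro psubset_card_mono) auto
    moreover have "Z x < Z w" if "x \<in> A" "w = f x" for x
      using preserves[of x w] that w wu by simp
    ultimately obtain s where "s \<in> P - f ` A" "(s, w) \<in> (steps A f)\<^sup>*"
      using less.hyps[of w] wP by blast
    then show ?thesis using w by (meson rtrancl.rtrancl_into_rtrancl steps_iff)
  next
    case False
    then show ?thesis using less.prems(1) by blast
  qed
qed

lemma into_band_rises:
  assumes "m \<in> A" "w \<in> A" "f w \<in> band P f Z m"
  shows "Z w < Z (f w)"
  using assms preserves[of m w] by (simp add: band_def)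

lemma leaves_band:
  assumes "m \<in> A" "u \<in> band P f Z m" "(u, v) \<in> (steps A f)\<^sup>+"
  shows "Z u < Z (f u)" "Z (f m) < Z v"
proof -
  \<comment> \<open>\<open>u\<close> is above \<open>m\<close>, so its image is above \<open>f m\<close>: one step already leaves the band.\<close>
  have "u \<in> A" using assms(3) by (meson steps_iff tranclD)
  then have *: "Z (f m) < Z (f u)" using assms preserves[of m u] by (simp add: band_def)
  then show "Z u < Z (f u)" using assms(2) by (simp add: band_def)
  then show "Z (f m) < Z v" using rises_after[OF assms(3)] * by simp
qed

text \<open>A point of the band has been reached by rising, for a predecessor above it would be above \<open>m\<close> and
  have its image above the band. The chain does not turn, so all earlier points rise too.\<close>

lemma band_trancl_rises:
  assumes "m \<in> A" "v \<in> band P f Z m" "(u, v) \<in> (steps A f)\<^sup>+"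
  shows "u \<in> A" "Z u < Z (f u)" "Z (f u) \<le> Z v"
proof -
  obtain w where w: "(u, w) \<in> (steps A f)\<^sup>*" "w \<in> A" "v = f w"
    using assms(3) by (meson steps_iff tranclD2)
  then have "Z w < Z (f w)" using into_band_rises assms by blast
  then show "u \<in> A" "Z u < Z (f u)" using rises_before w by blast+
  then show "Z (f u) \<le> Z v" using rises_after assms(3) by blast
qed

lemma band_has_start:
  assumes "m \<in> A" "u \<in> band P f Z m"
  shows "\<exists>s \<in> P - f ` A. (s, u) \<in> (steps A f)\<^sup>*"
  using assms into_band_rises by (intro rising_has_start) (auto simp: band_def)

end


section \<open>Maps preserving two coordinates\<close>

definition strictly_between :: "int \<Rightarrow> int \<Rightarrow> int \<Rightarrow> bool" where
  "strictly_between a b c \<longleftrightarrow> min a b < c \<and> c < max a b"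

lemma strictly_between_reorient:
  assumes "s = 1 \<or> s = -1"
  shows "strictly_between (s * a) (s * b) (s * c) \<longleftrightarrow> strictly_between a b c"
  using assms by (elim disjE) (auto simp: strictly_between_def)

definition between_points :: "'a set \<Rightarrow> ('a \<Rightarrow> int) \<Rightarrow> ('a \<Rightarrow> int) \<Rightarrow> 'a \<Rightarrow> 'a \<Rightarrow> 'a set" where
  "between_points P X Y p q =
     {u \<in> P. strictly_between (X p) (X q) (X u) \<or> strictly_between (Y p) (Y q) (Y u)}"

text \<open>With \<open>X\<close> drawn to the right and \<open>Y\<close> upwards, these are the points that \<open>f\<close> moves to the right and
  up. The last point of a chain, where \<open>f\<close> is undefined, does not count.\<close>

definition north_east :: "'a set \<Rightarrow> ('a \<Rightarrow> 'a) \<Rightarrow> ('a \<Rightarrow> int) \<Rightarrow> ('a \<Rightarrow> int) \<Rightarrow> 'a set" where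
  "north_east A f X Y = {u \<in> A. X u < X (f u) \<and> Y u < Y (f u)}"

context
  fixes P A :: "'a set" and f :: "'a \<Rightarrow> 'a" and X Y :: "'a \<Rightarrow> int"
  assumes X: "coordinate_preserving P A f X" and Y: "coordinate_preserving P A f Y"
begin

text \<open>There are fewer chains than points in \<open>U \<union> V\<close>, so two of these points share a start. A chain leaves a
  band in one step and never comes back, so one point is in \<open>U\<close> and the other in \<open>V\<close>. The two cases tell
  which comes first on the chain. Being in the band of positions forces the chain to move right,
  being in the band of values forces it to move up.\<close>

lemma crowded_bands:
  assumes U: "U \<subseteq> band P f X p" and V: "V \<subseteq> band P f Y q"
    and large: "card (P - f ` A) < card (U \<union> V)"
    and pq: "p \<in> A" "q \<in> A"
  obtains (X_first) u v where "u \<in> U" "v \<in> V" "u \<in> north_east A f X Y" "Y (f u) \<le> Y v"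
    | (Y_first) u v where "u \<in> V" "v \<in> U" "u \<in> north_east A f X Y" "X (f u) \<le> X v"
proof -
  have "\<forall>u \<in> U \<union> V. \<exists>s. s \<in> P - f ` A \<and> (s, u) \<in> (steps A f)\<^sup>*"
    using U V coordinate_preserving.band_has_start[OF X pq(1)]
      coordinate_preserving.band_has_start[OF Y pq(2)] by blast
  then obtain s where s: "\<And>u. u \<in> U \<union> V \<Longrightarrow> s u \<in> P - f ` A"
    "\<And>u. u \<in> U \<union> V \<Longrightarrow> (s u, u) \<in> (steps A f)\<^sup>*"
    by metis
  have "\<not> inj_on s (U \<union> V)"
  proof
    assume "inj_on s (U \<union> V)"
    then have "card (U \<union> V) \<le> card (P - f ` A)"
      using s(1) coordinate_preserving.finite_points[OF X] by (intro card_inj_on_le[of s]) auto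
    then show False using large by simp
  qed
  then obtain u' v' where "u' \<in> U \<union> V" "v' \<in> U \<union> V" "u' \<noteq> v'" "s u' = s v'"
    by (auto simp: inj_on_def)
  then obtain u v where uv: "u \<in> U \<union> V" "v \<in> U \<union> V" and R: "(u, v) \<in> (steps A f)\<^sup>+"
    using steps_linear s(2) by metis
  have X_out: "v \<notin> U" if "u \<in> U"
    using coordinate_preserving.leaves_band(2)[OF X pq(1) _ R] that U by (force simp: band_def)
  have Y_out: "v \<notin> V" if "u \<in> V"
    using coordinate_preserving.leaves_band(2)[OF Y pq(2) _ R] that V by (force simp: band_def)
  consider "u \<in> U" "v \<in> V" | "u \<in> V" "v \<in> U"
    using X_out Y_out uv by blast
  then show thesis
  proof cases
    case 1
    then have "u \<in> band P f X p" "v \<in> band P f Y q" using U V by auto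
    note coordinate_preserving.leaves_band(1)[OF X pq(1) this(1) R]
      coordinate_preserving.band_trancl_rises[OF Y pq(2) this(2) R]
    then show ?thesis using X_first[OF 1] by (auto simp: north_east_def)
  next
    case 2
    then have "u \<in> band P f Y q" "v \<in> band P f X p" using U V by auto
    note coordinate_preserving.leaves_band(1)[OF Y pq(2) this(1) R]
      coordinate_preserving.band_trancl_rises[OF X pq(1) this(2) R]
    then show ?thesis using Y_first[OF 2] by (auto simp: north_east_def)
  qed
qed

text \<open>Of the two points given by \<open>crowded_bands\<close>, take the earlier one, \<open>u\<close>, say in the band of \<open>X\<close>. If it were
  above \<open>m\<close> in \<open>Y\<close>, its image and all later points would be above the band of \<open>Y\<close>; so it is below.\<close>

lemma north_east_sees:
  assumes m: "m \<in> north_east A f X Y"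
    and large: "card (P - f ` A) < card (between_points P X Y m (f m))"
  shows "(\<exists>u\<in>north_east A f X Y. X m < X u \<and> X u < X (f m) \<and> Y u < Y m) \<or>
         (\<exists>u\<in>north_east A f X Y. Y m < Y u \<and> Y u < Y (f m) \<and> X u < X m)"
proof -
  have mA: "m \<in> A" and mP: "m \<in> P"
    using m coordinate_preserving.domain[OF X] by (auto simp: north_east_def)
  have "between_points P X Y m (f m) = band P f X m \<union> band P f Y m"
    using m by (auto simp: between_points_def strictly_between_def band_def north_east_def)
  then have "card (P - f ` A) < card (band P f X m \<union> band P f Y m)" using large by simp
  from order_refl order_refl this mA mA show ?thesis
  proof (cases rule: crowded_bands)
    case (X_first u v)
    have uP: "u \<in> P" "u \<in> A" using X_first by (auto simp: band_def north_east_def)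
    have "Y u \<noteq> Y m"
      using inj_onD[OF coordinate_preserving.inj_coordinate[OF Y] _ uP(1) mP] X_first by (auto simp: band_def)
    moreover have "\<not> Y m < Y u"
      using coordinate_preserving.preserves[OF Y mA uP(2)] X_first by (auto simp: band_def)
    ultimately show ?thesis using X_first by (auto simp: band_def)
  next
    case (Y_first u v)
    have uP: "u \<in> P" "u \<in> A" using Y_first by (auto simp: band_def north_east_def)
    have "X u \<noteq> X m"
      using inj_onD[OF coordinate_preserving.inj_coordinate[OF X] _ uP(1) mP] Y_first by (auto simp: band_def)
    moreover have "\<not> X m < X u"
      using coordinate_preserving.preserves[OF X mA uP(2)] Y_first by (auto simp: band_def)
    ultimately show ?thesis using Y_first by (auto simp: band_def)
  qed
qed

text \<open>The staircase argument. It is enough to build the two consecutive steps \<open>p\<close> and \<open>q\<close> at which the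
  direction of sight changes.\<close>

lemma north_east_empty:
  assumes large: "\<And>p q. p \<in> P \<Longrightarrow> q \<in> P \<Longrightarrow> p \<noteq> q \<Longrightarrow>
                    card (P - f ` A) < card (between_points P X Y p q)"
  shows "north_east A f X Y = {}"
proof (rule ccontr)
  let ?NE = "north_east A f X Y"
  assume ne: "?NE \<noteq> {}"
  have ne_P: "?NE \<subseteq> P" and ne_A: "?NE \<subseteq> A"
    using coordinate_preserving.domain[OF X] by (auto simp: north_east_def)
  have fin: "finite ?NE" using finite_subset[OF ne_P coordinate_preserving.finite_points[OF X]] .
  have sees: "(\<exists>u\<in>?NE. X m < X u \<and> X u < X (f m) \<and> Y u < Y m) \<or>
         (\<exists>u\<in>?NE. Y m < Y u \<and> Y u < Y (f m) \<and> X u < X m)" if "m \<in> ?NE" for m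
  proof (rule north_east_sees[OF that large])
    show "m \<in> P" "f m \<in> P" using that ne_P ne_A coordinate_preserving.range[OF X] by auto
    show "m \<noteq> f m" using that by (auto simp: north_east_def)
  qed
  have leftmost: "\<exists>q\<in>T. \<forall>u\<in>T. X q \<le> X u" if "T \<subseteq> ?NE" "T \<noteq> {}" for T
    using ex_is_arg_min_if_finite[of T X] that finite_subset[OF that(1) fin]
    by (auto simp: is_arg_min_linorder)
  \<comment> \<open>The steps of the staircase that see towards the south-east; the leftmost step is one.\<close>
  define M where "M = {p \<in> ?NE. (\<forall>u\<in>?NE. X u \<le> X p \<longrightarrow> Y p \<le> Y u) \<and>
    (\<exists>u\<in>?NE. X p < X u \<and> X u < X (f p) \<and> Y u < Y p)}"
  obtain x where x: "x \<in> ?NE" "\<And>u. u \<in> ?NE \<Longrightarrow> X x \<le> X u"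
    using leftmost[of "?NE"] ne by auto
  have "x \<in> M"
  proof -
    have "\<forall>u\<in>?NE. X u \<le> X x \<longrightarrow> Y x \<le> Y u"
    proof (intro ballI impI)
      fix u assume u: "u \<in> ?NE" "X u \<le> X x"
      then have "X u = X x" using x(2)[OF u(1)] by simp
      then show "Y x \<le> Y u" using inj_onD[OF coordinate_preserving.inj_coordinate[OF X]] u x(1) ne_P by blast
    qed
    then show ?thesis using sees[OF x(1)] x by (fastforce simp: M_def)
  qed
  moreover have "finite M" using fin by (simp add: M_def)
  ultimately have "\<exists>p\<in>M. \<forall>u\<in>M. X u \<le> X p"
    using ex_is_arg_min_if_finite[of M "\<lambda>u. - X u"] by (auto simp: is_arg_min_linorder)
  then obtain p where p: "p \<in> M" "\<And>u. u \<in> M \<Longrightarrow> X u \<le> X p" by blast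
  have p_ne: "p \<in> ?NE" and p_min: "\<And>u. u \<in> ?NE \<Longrightarrow> X u \<le> X p \<Longrightarrow> Y p \<le> Y u"
    using p(1) by (auto simp: M_def)
  obtain w where w: "w \<in> ?NE" "X w < X (f p)" "Y w < Y p" using p(1) by (auto simp: M_def)
  \<comment> \<open>The next step of the staircase is the leftmost point below \<open>p\<close>.\<close>
  have "\<exists>q\<in>{u \<in> ?NE. Y u < Y p}. \<forall>u\<in>{u \<in> ?NE. Y u < Y p}. X q \<le> X u"
    using w by (intro leftmost) auto
  then obtain q where q: "q \<in> ?NE" "Y q < Y p" and q_left: "\<And>u. u \<in> ?NE \<Longrightarrow> Y u < Y p \<Longrightarrow> X q \<le> X u"
    by blast
  have qfp: "X q < X (f p)" using q_left[of w] w by simp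
  have pq: "X p < X q" using p_min[OF q(1)] q(2) by force
  have q_min: "Y q \<le> Y u" if u: "u \<in> ?NE" "X u \<le> X q" for u
  proof (rule ccontr)
    assume "\<not> Y q \<le> Y u"
    then have *: "Y u < Y q" by simp
    then have "X u = X q" using q_left[of u] u q(2) by simp
    then have "u = q" using inj_onD[OF coordinate_preserving.inj_coordinate[OF X]] u q(1) ne_P by blast
    then show False using * by simp
  qed
  \<comment> \<open>By the choice of \<open>p\<close> the step \<open>q\<close> does not see south-east, so it sees north-west. What it sees is
    left of \<open>q\<close>, hence not below \<open>p\<close>, and therefore \<open>q\<close> sees \<open>p\<close> as well.\<close>
  have "q \<notin> M" using p(2)[of q] pq by auto
  then have "\<not> (\<exists>u\<in>?NE. X q < X u \<and> X u < X (f q) \<and> Y u < Y q)"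
    using q_min q(1) by (auto simp: M_def)
  then obtain z where z: "z \<in> ?NE" "Y z < Y (f q)" "X z < X q"
    using sees[OF q(1)] by blast
  have pfq: "Y p < Y (f q)" using q_left[OF z(1)] z by fastforce
  have none: False if "u \<in> ?NE" "X u < X q" "Y u < Y p" for u
    using q_left[OF that(1,3)] that(2) by simp
  define U where "U = {u \<in> P. X p < X u \<and> X u < X q}"
  define V where "V = {u \<in> P. Y q < Y u \<and> Y u < Y p}"
  have U: "U \<subseteq> band P f X p" using qfp by (auto simp: U_def band_def)
  have V: "V \<subseteq> band P f Y q" using pfq by (auto simp: V_def band_def)
  \<comment> \<open>Because \<open>p\<close> and \<open>q\<close> see each other, the bands cover what is between them.\<close>
  have "between_points P X Y p q = U \<union> V"
    using pq q(2) by (auto simp: between_points_def strictly_between_def U_def V_def)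
  moreover have "card (P - f ` A) < card (between_points P X Y p q)"
    using large p_ne q(1) ne_P pq by blast
  ultimately have crowd: "card (P - f ` A) < card (U \<union> V)" by simp
  have pq_A: "p \<in> A" "q \<in> A" using p_ne q(1) ne_A by auto
  from U V crowd pq_A show False
  proof (cases rule: crowded_bands)
    case (X_first u v)
    then show False using none[of u] by (auto simp: U_def V_def north_east_def)
  next
    case (Y_first u v)
    then show False using none[of u] by (auto simp: U_def V_def north_east_def)
  qed
qed

end

text \<open>A moved point moves in both coordinates by injectivity. Reversing the coordinates in which it
  goes down turns it into a north-east moving point and leaves the hypotheses unchanged.\<close>

lemma bi_coordinate_preserving_is_identity:
  assumes X: "coordinate_preserving P A f X" and Y: "coordinate_preserving P A f Y"
    and large: "\<And>p q. p \<in> P \<Longrightarrow> q \<in> P \<Longrightarrow> p \<noteq> q \<Longrightarrow>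
                    card (P - f ` A) < card (between_points P X Y p q)"
    and "a \<in> A"
  shows "f a = a"
proof (rule ccontr)
  assume "f a \<noteq> a"
  have aP: "a \<in> P" "f a \<in> P"
    using \<open>a \<in> A\<close> coordinate_preserving.domain[OF X] coordinate_preserving.range[OF X] by auto
  have "X a \<noteq> X (f a)"
    using inj_onD[OF coordinate_preserving.inj_coordinate[OF X] _ aP] \<open>f a \<noteq> a\<close> by auto
  then obtain s :: int where s: "s = 1 \<or> s = -1" "s * X a < s * X (f a)"
    using that[of 1] that[of "-1"] by (cases "X a < X (f a)") auto
  have "Y a \<noteq> Y (f a)"
    using inj_onD[OF coordinate_preserving.inj_coordinate[OF Y] _ aP] \<open>f a \<noteq> a\<close> by auto
  then obtain t :: int where t: "t = 1 \<or> t = -1" "t * Y a < t * Y (f a)"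
    using that[of 1] that[of "-1"] by (cases "Y a < Y (f a)") auto
  have between: "between_points P (\<lambda>u. s * X u) (\<lambda>u. t * Y u) = between_points P X Y"
    using strictly_between_reorient[OF s(1)] strictly_between_reorient[OF t(1)]
    by (simp add: between_points_def fun_eq_iff)
  have "north_east A f (\<lambda>u. s * X u) (\<lambda>u. t * Y u) = {}"
    by (rule north_east_empty[OF coordinate_preserving.reorient[OF X s(1)]
          coordinate_preserving.reorient[OF Y t(1)]])
      (simp only: between large not_False_eq_True)
  then show False using s(2) t(2) \<open>a \<in> A\<close> by (auto simp: north_east_def)
qed


section \<open>Breadth and points between two entries\<close>

abbreviation between :: "nat \<Rightarrow> (nat \<Rightarrow> nat) \<Rightarrow> nat \<Rightarrow> nat \<Rightarrow> nat set" where
  "between n \<sigma> \<equiv> between_points {1..n} int (\<lambda>i. int (\<sigma> i))"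

lemma breadth_ge_iff:
  assumes "n \<ge> 2"
  shows "breadth n \<sigma> \<ge> b \<longleftrightarrow>
    (\<forall>i\<in>{1..n}. \<forall>j\<in>{1..n}. i \<noteq> j \<longrightarrow> b \<le> entry_dist \<sigma> i j)"
proof -
  let ?D = "{entry_dist \<sigma> i j | i j. i \<in> {1..n} \<and> j \<in> {1..n} \<and> i \<noteq> j}"
  have "?D \<subseteq> (\<lambda>(i, j). entry_dist \<sigma> i j) ` ({1..n} \<times> {1..n})" by auto
  then have "finite ?D" by (rule finite_subset) auto
  moreover have "entry_dist \<sigma> 1 2 \<in> ?D" using assms by force
  ultimately have "b \<le> Min ?D \<longleftrightarrow> (\<forall>d\<in>?D. b \<le> d)" by (subst Min_ge_iff) auto
  then show ?thesis unfolding breadth_def by blast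
qed

lemma card_strictly_between:
  assumes "\<sigma> permutes {1..n}" "i \<in> {1..n}" "j \<in> {1..n}" "i \<noteq> j"
  shows "int (card {u \<in> {1..n}. strictly_between (int (\<sigma> i)) (int (\<sigma> j)) (int (\<sigma> u))}) =
    \<bar>int (\<sigma> i) - int (\<sigma> j)\<bar> - 1"
proof -
  let ?S = "{u \<in> {1..n}. strictly_between (int (\<sigma> i)) (int (\<sigma> j)) (int (\<sigma> u))}"
  let ?I = "{min (\<sigma> i) (\<sigma> j)<..<max (\<sigma> i) (\<sigma> j)}"
  have ne: "\<sigma> i \<noteq> \<sigma> j" using permutes_inj[OF assms(1)] assms(4) by (auto simp: inj_on_def)
  have ij: "\<sigma> i \<in> {1..n}" "\<sigma> j \<in> {1..n}" using assms permutes_in_image by metis+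
  have "\<sigma> ` ?S = ?I"
  proof (intro equalityI subsetI)
    fix c assume c: "c \<in> ?I"
    then have "c \<in> {1..n}" using ij by auto
    then obtain u where "u \<in> {1..n}" "c = \<sigma> u" using permutes_image[OF assms(1)] by blast
    then show "c \<in> \<sigma> ` ?S" using c by (auto simp: strictly_between_def min_def max_def)
  qed (auto simp: strictly_between_def min_def max_def)
  then have "card ?I = card ?S"
    using card_image[OF inj_on_subset[OF permutes_inj[OF assms(1)] subset_UNIV], of ?S] by simp
  then show ?thesis using ne by (cases "\<sigma> i" "\<sigma> j" rule: linorder_cases) simp_all
qed

lemma entry_dist_eq_cards:
  assumes "\<sigma> permutes {1..n}" "i \<in> {1..n}" "j \<in> {1..n}" "i \<noteq> j"
  shows "entry_dist \<sigma> i j =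
    int (card {u \<in> {1..n}. strictly_between (int i) (int j) (int u)}) +
    int (card {u \<in> {1..n}. strictly_between (int (\<sigma> i)) (int (\<sigma> j)) (int (\<sigma> u))}) + 2"
  using card_strictly_between[OF permutes_id assms(2-4)] card_strictly_between[OF assms]
  by (simp add: entry_dist_def)

lemma card_between_le:
  assumes "\<sigma> permutes {1..n}" "i \<in> {1..n}" "j \<in> {1..n}" "i \<noteq> j"
  shows "int (card (between n \<sigma> i j)) \<le> entry_dist \<sigma> i j - 2"
proof -
  let ?X = "{u \<in> {1..n}. strictly_between (int i) (int j) (int u)}"
  let ?Y = "{u \<in> {1..n}. strictly_between (int (\<sigma> i)) (int (\<sigma> j)) (int (\<sigma> u))}"
  have "between n \<sigma> i j = ?X \<union> ?Y" by (auto simp: between_points_def)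
  then have "card (between n \<sigma> i j) \<le> card ?X + card ?Y" by (simp add: card_Un_le)
  then show ?thesis using entry_dist_eq_cards[OF assms] by simp
qed

text \<open>If no entry is strictly between \<open>i\<close> and \<open>j\<close> in both position and value, the distance counts the
  entries between them exactly. Otherwise such an entry \<open>r\<close> is closer to \<open>i\<close> than \<open>j\<close> is, and all
  that is between \<open>i\<close> and \<open>r\<close> is between \<open>i\<close> and \<open>j\<close>.\<close>

lemma card_between_ge:
  assumes \<sigma>: "\<sigma> permutes {1..n}"
    and far: "\<And>i j. i \<in> {1..n} \<Longrightarrow> j \<in> {1..n} \<Longrightarrow> i \<noteq> j \<Longrightarrow> b + 2 \<le> entry_dist \<sigma> i j"
    and "i \<in> {1..n}" "j \<in> {1..n}" "i \<noteq> j"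
  shows "b \<le> int (card (between n \<sigma> i j))"
  using assms(3-)
proof (induction "nat (entry_dist \<sigma> i j)" arbitrary: j rule: less_induct)
  case less
  let ?X = "{u \<in> {1..n}. strictly_between (int i) (int j) (int u)}"
  let ?Y = "{u \<in> {1..n}. strictly_between (int (\<sigma> i)) (int (\<sigma> j)) (int (\<sigma> u))}"
  show ?case
  proof (cases "?X \<inter> ?Y = {}")
    case True
    have "between n \<sigma> i j = ?X \<union> ?Y" by (auto simp: between_points_def)
    then have "card (between n \<sigma> i j) = card ?X + card ?Y"
      using True by (simp add: card_Un_disjoint)
    then show ?thesis
      using entry_dist_eq_cards[OF \<sigma> less.prems] far[OF less.prems] by simp
  next
    case False
    then obtain r where r: "r \<in> ?X" "r \<in> ?Y" by blast
    have "entry_dist \<sigma> i r < entry_dist \<sigma> i j" "0 \<le> entry_dist \<sigma> i r"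
      using r by (auto simp: entry_dist_def strictly_between_def min_def max_def split: if_splits)
    then have "b \<le> int (card (between n \<sigma> i r))"
      using r less by (intro less.hyps) (auto simp: strictly_between_def)
    also have "between n \<sigma> i r \<subseteq> between n \<sigma> i j"
      using r by (fastforce simp: between_points_def strictly_between_def min_def max_def split: if_splits)
    then have "int (card (between n \<sigma> i r)) \<le> int (card (between n \<sigma> i j))"
      by (simp add: card_mono between_points_def)
    finally show ?thesis .
  qed
qed


section \<open>Patterns\<close>

lemma nth_pos_less_iff:
  assumes "finite A" "i \<in> {1..card A}" "j \<in> {1..card A}"
  shows "nth_pos A i < nth_pos A j \<longleftrightarrow> i < j"
proof -
  have *: "nth_pos A i < nth_pos A j" if "i \<in> {1..card A}" "j \<in> {1..card A}" "i < j" for i j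
    unfolding nth_pos_def using that
    by (intro sorted_wrt_nth_less[OF strict_sorted_list_of_set]) auto
  show ?thesis using *[of i j] *[of j i] assms by (cases i j rule: linorder_cases) auto
qed

text \<open>A chosen entry strictly between two others in position or value gets an index or a value strictly
  between theirs in the pattern, and every intermediate index or value comes from such an entry.\<close>

lemma pattern_close_iff:
  assumes \<sigma>: "\<sigma> permutes {1..n}" and A: "A \<subseteq> {1..n}" and i: "i \<in> {1..card A}" "j \<in> {1..card A}" "i < j"
  shows "j = i + 1 \<and> \<bar>int (pattern_of \<sigma> A j) - int (pattern_of \<sigma> A i)\<bar> \<le> 1 \<longleftrightarrow>
     between n \<sigma> (nth_pos A i) (nth_pos A j) \<inter> A = {}"
proof -
  have fin: "finite A" using A finite_subset by blast
  let ?\<pi> = "pattern_of \<sigma> A" and ?a = "nth_pos A"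
  have "is_pattern \<sigma> A ?\<pi>"
    using is_pattern_pattern_of[OF fin] permutes_inj[OF \<sigma>] inj_on_subset by blast
  then have \<pi>: "?\<pi> permutes {1..card A}" and
    less: "\<And>i j. i \<in> {1..card A} \<Longrightarrow> j \<in> {1..card A} \<Longrightarrow> ?\<pi> i < ?\<pi> j \<longleftrightarrow> \<sigma> (?a i) < \<sigma> (?a j)"
    by (auto simp: is_pattern_def)
  have A_eq: "A = ?a ` {1..card A}" using bij_betw_nth_pos[OF fin] by (simp add: bij_betw_def)
  have aP: "?a l \<in> {1..n}" if "l \<in> {1..card A}" for l using that A A_eq by blast
  have b: "?a l \<in> between n \<sigma> (?a i) (?a j) \<longleftrightarrow> i < l \<and> l < j \<or>
      strictly_between (int (?\<pi> i)) (int (?\<pi> j)) (int (?\<pi> l))" if l: "l \<in> {1..card A}" for l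
    using l i aP[OF l] less nth_pos_less_iff[OF fin]
    by (auto simp: between_points_def strictly_between_def min_less_iff_disj less_max_iff_disj)
  have "between n \<sigma> (?a i) (?a j) \<inter> A = {} \<longleftrightarrow>
    (\<forall>l\<in>{1..card A}. \<not> (i < l \<and> l < j)) \<and>
    (\<forall>l\<in>{1..card A}. \<not> strictly_between (int (?\<pi> i)) (int (?\<pi> j)) (int (?\<pi> l)))"
  proof -
    have "between n \<sigma> (?a i) (?a j) \<inter> ?a ` {1..card A} = {} \<longleftrightarrow>
        (\<forall>l\<in>{1..card A}. ?a l \<notin> between n \<sigma> (?a i) (?a j))"
      by blast
    then show ?thesis unfolding A_eq[symmetric] using b by blast
  qed
  moreover have "(\<forall>l\<in>{1..card A}. \<not> (i < l \<and> l < j)) \<longleftrightarrow> j = i + 1"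
  proof
    assume "\<forall>l\<in>{1..card A}. \<not> (i < l \<and> l < j)"
    then have "\<not> (i + 1 \<in> {1..card A} \<and> i + 1 < j)" by auto
    then show "j = i + 1" using i by simp
  qed auto
  moreover have "(\<forall>l\<in>{1..card A}. \<not> strictly_between (int (?\<pi> i)) (int (?\<pi> j)) (int (?\<pi> l))) \<longleftrightarrow>
    \<bar>int (?\<pi> j) - int (?\<pi> i)\<bar> \<le> 1"
  proof -
    let ?S = "{l \<in> {1..card A}. strictly_between (int (?\<pi> i)) (int (?\<pi> j)) (int (?\<pi> l))}"
    have "int (card ?S) = \<bar>int (?\<pi> i) - int (?\<pi> j)\<bar> - 1"
      using card_strictly_between[OF \<pi>] i by simp
    moreover have "?\<pi> i \<noteq> ?\<pi> j" using permutes_inj[OF \<pi>] i by (auto simp: inj_on_def)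
    moreover have "card ?S = 0 \<longleftrightarrow> (\<forall>l\<in>{1..card A}. l \<notin> ?S)"
      by (subst card_0_eq) auto
    moreover have "\<bar>int (?\<pi> j) - int (?\<pi> i)\<bar> \<le> 1 \<longleftrightarrow> card ?S = 0"
      using calculation(1,2) by linarith
    ultimately show ?thesis by simp
  qed
  ultimately show ?thesis by blast
qed

text \<open>Sending the \<open>i\<close>-th entry of \<open>A\<close> to the \<open>i\<close>-th entry of \<open>B\<close> always preserves the order of positions;
  it preserves the order of values because the patterns agree.\<close>

lemma equal_patterns_imp_equal:
  assumes \<sigma>: "\<sigma> permutes {1..n}" and A: "A \<subseteq> {1..n}" and B: "B \<subseteq> {1..n}"
    and card: "card A = card B" and eq: "pattern_of \<sigma> A = pattern_of \<sigma> B"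
    and large: "\<And>i j. i \<in> {1..n} \<Longrightarrow> j \<in> {1..n} \<Longrightarrow> i \<noteq> j \<Longrightarrow> n - card B < card (between n \<sigma> i j)"
  shows "A = B"
proof -
  let ?a = "nth_pos A" and ?b = "nth_pos B" and ?m = "card B"
  have fin: "finite A" "finite B" using A B finite_subset by blast+
  have inj: "inj_on \<sigma> S" for S using permutes_inj[OF \<sigma>] inj_on_subset by blast
  have bij: "bij_betw ?a {1..?m} A" "bij_betw ?b {1..?m} B"
    using bij_betw_nth_pos fin card by metis+
  define f where "f x = ?b (inv_into {1..?m} ?a x)" for x
  have fa: "f (?a l) = ?b l" if "l \<in> {1..?m}" for l
    using that bij(1) by (simp add: f_def bij_betw_def inv_into_f_f)
  have A_eq: "A = ?a ` {1..?m}" and B_eq: "B = ?b ` {1..?m}" using bij by (auto simp: bij_betw_def)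
  have "f ` ?a ` {1..?m} = ?b ` {1..?m}" unfolding image_image using fa by (intro image_cong) auto
  then have fA: "f ` A = B" by (simp only: A_eq[symmetric] B_eq[symmetric])
  have ord: "\<sigma> (?b i) < \<sigma> (?b j) \<longleftrightarrow> \<sigma> (?a i) < \<sigma> (?a j)" if "i \<in> {1..?m}" "j \<in> {1..?m}" for i j
    using is_pattern_pattern_of[OF fin(1) inj] is_pattern_pattern_of[OF fin(2) inj] eq that card
    by (auto simp: is_pattern_def)
  have pos: "?b i < ?b j \<longleftrightarrow> ?a i < ?a j" if "i \<in> {1..?m}" "j \<in> {1..?m}" for i j
    using nth_pos_less_iff fin card that by simp
  have AP: "A \<subseteq> {1..n}" "f ` A \<subseteq> {1..n}" using A B fA by simp_all
  have AE: "\<exists>i\<in>{1..?m}. x = ?a i" if "x \<in> A" for x using that A_eq by blast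
  have positions: "coordinate_preserving {1..n} A f int"
  proof (unfold_locales, goal_cases)
    case (5 x y)
    then obtain i j where ij: "i \<in> {1..?m}" "j \<in> {1..?m}" "x = ?a i" "y = ?a j" using AE by meson
    show ?case using pos[OF ij(1,2)] fa[OF ij(1)] fa[OF ij(2)] ij(3,4) by simp
  qed (rule finite_atLeastAtMost AP inj_on_of_nat)+
  have heights: "coordinate_preserving {1..n} A f (\<lambda>i. int (\<sigma> i))"
  proof (unfold_locales, goal_cases)
    case 4
    show ?case unfolding inj_on_def using permutes_inj[OF \<sigma>] by (auto dest: injD)
  next
    case (5 x y)
    then obtain i j where ij: "i \<in> {1..?m}" "j \<in> {1..?m}" "x = ?a i" "y = ?a j" using AE by meson
    show ?case using ord[OF ij(1,2)] fa[OF ij(1)] fa[OF ij(2)] ij(3,4) by simp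
  qed (rule finite_atLeastAtMost AP)+
  have "card ({1..n} - f ` A) = n - card B"
    unfolding fA using B fin by (simp add: card_Diff_subset)
  then have "card ({1..n} - f ` A) < card (between n \<sigma> i j)"
    if "i \<in> {1..n}" "j \<in> {1..n}" "i \<noteq> j" for i j
    using large[OF that] by (simp only:)
  then have "f x = x" if "x \<in> A" for x
    using bi_coordinate_preserving_is_identity[OF positions heights] that by blast
  then have "f ` A = A" by (simp add: image_cong)
  then show ?thesis using fA by simp
qed


section \<open>Prolific king permutations\<close>

theorem theorem2p10:
  fixes n k :: nat and \<sigma> :: "nat \<Rightarrow> nat"
  assumes "1 \<le> k" and "k \<le> n - 1" and "\<sigma> permutes {1..n}"
  shows "prolific_in_kings k n \<sigma> \<longleftrightarrow> breadth n \<sigma> \<ge> int k + 3"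
proof -
  note \<sigma> = assms(3)
  have n: "n \<ge> 2" and m: "n - k \<ge> 1" using assms by auto
  have inj: "inj_on \<sigma> S" for S using permutes_inj[OF \<sigma>] inj_on_subset by blast
  have pattern: "pattern_of \<sigma> A permutes {1..card A}" if "A \<subseteq> {1..n}" for A
    using is_pattern_pattern_of[OF _ inj] that finite_subset by (auto simp: is_pattern_def)
  show ?thesis
  proof
    assume prol: "prolific_in_kings k n \<sigma>"
    show "breadth n \<sigma> \<ge> int k + 3"
    proof (rule ccontr)
      assume "\<not> breadth n \<sigma> \<ge> int k + 3"
      then obtain i' j' where "i' \<in> {1..n}" "j' \<in> {1..n}" "i' \<noteq> j'" "\<not> int k + 3 \<le> entry_dist \<sigma> i' j'"
        unfolding breadth_ge_iff[OF n] by blast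
      moreover have "entry_dist \<sigma> i' j' = entry_dist \<sigma> j' i'" by (simp add: entry_dist_def)
      ultimately obtain p q where pq: "p \<in> {1..n}" "q \<in> {1..n}" "p < q" and
        near: "entry_dist \<sigma> p q \<le> int k + 2"
        by (cases i' j' rule: linorder_cases) auto
      \<comment> \<open>Two entries must survive the deletion to violate the king condition; single entries all form
        the same pattern.\<close>
      have "n - k \<noteq> 1"
      proof
        assume m1: "n - k = 1"
        have "pattern_of \<sigma> {x} = id" if "x \<in> {1..n}" for x
          using pattern[of "{x}"] that by simp
        then have "pattern_of \<sigma> {p} = pattern_of \<sigma> {q}" using pq by simp
        moreover have "{p} \<noteq> {q}" using pq by simp
        moreover have "pattern_of \<sigma> {p} \<noteq> pattern_of \<sigma> {q}" if "{p} \<noteq> {q}"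
        proof -
          have "{p} \<subseteq> {1..n} \<and> card {p} = n - k \<and> {q} \<subseteq> {1..n} \<and> card {q} = n - k \<and> {p} \<noteq> {q}"
            using pq m1 that by simp
          then show ?thesis using prol unfolding prolific_in_kings_def by blast
        qed
        ultimately show False by blast
      qed
      then have m2: "n - k \<ge> 2" using m by simp
      \<comment> \<open>Delete everything between \<open>p\<close> and \<open>q\<close>, and further entries up to a total of \<open>k\<close>.\<close>
      let ?W = "between n \<sigma> p q"
      have W: "?W \<subseteq> {1..n} - {p, q}" by (auto simp: between_points_def strictly_between_def)
      have cardW: "card ?W \<le> k" using card_between_le[OF \<sigma> pq(1,2)] pq near by simp
      have "card ({1..n} - {p, q}) = n - 2" using pq by (subst card_Diff_subset) auto
      then have C: "k \<le> card ({1..n} - {p, q})" "finite ({1..n} - {p, q})" using m2 by auto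
      then obtain D where D: "?W \<subseteq> D" "D \<subseteq> {1..n} - {p, q}" "card D = k"
        using exists_subset_between[OF cardW _ W] C by blast
      define A where "A = {1..n} - D"
      have "D \<subseteq> {1..n}" using D(2) by blast
      then have "card A = n - k"
        using D(3) finite_subset[of D "{1..n}"] by (simp add: A_def card_Diff_subset)
      then have A: "A \<subseteq> {1..n}" "card A = n - k" "p \<in> A" "q \<in> A" "?W \<inter> A = {}"
        using D pq by (auto simp: A_def)
      then have fin: "finite A" using finite_subset by blast
      have "A = nth_pos A ` {1..card A}" using bij_betw_nth_pos[OF fin] by (simp add: bij_betw_def)
      then obtain i j where ij: "i \<in> {1..card A}" "j \<in> {1..card A}" "p = nth_pos A i" "q = nth_pos A j"
        using A by blast
      then have "i < j" using nth_pos_less_iff[OF fin] pq by blast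
      then have "j = i + 1" "\<bar>int (pattern_of \<sigma> A j) - int (pattern_of \<sigma> A i)\<bar> \<le> 1"
        using pattern_close_iff[OF \<sigma> A(1) ij(1,2)] A(5) ij by auto
      moreover have "pattern_of \<sigma> A \<in> kings (n - k)" using prol A by (simp add: prolific_in_kings_def)
      ultimately show False using ij A(2) by (force simp: kings_def)
    qed
  next
    assume "breadth n \<sigma> \<ge> int k + 3"
    then have far: "int k + 3 \<le> entry_dist \<sigma> i j" if "i \<in> {1..n}" "j \<in> {1..n}" "i \<noteq> j" for i j
      using that breadth_ge_iff[OF n] by blast
    have large: "k < card (between n \<sigma> i j)" if "i \<in> {1..n}" "j \<in> {1..n}" "i \<noteq> j" for i j
    proof -
      have "int k + 1 + 2 \<le> entry_dist \<sigma> i j" if "i \<in> {1..n}" "j \<in> {1..n}" "i \<noteq> j" for i j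
        using far[OF that] by simp
      from card_between_ge[OF \<sigma> this that] show ?thesis by linarith
    qed
    show "prolific_in_kings k n \<sigma>"
      unfolding prolific_in_kings_def
    proof (intro conjI allI impI)
      have "\<bar>int (\<sigma> (i + 1)) - int (\<sigma> i)\<bar> > 1" if "i \<in> {1..<n}" for i
        using far[of i "i + 1"] that assms(1) by (simp add: entry_dist_def)
      then show "\<sigma> \<in> kings n" using \<sigma> by (simp add: kings_def)
    next
      fix A assume A: "A \<subseteq> {1..n} \<and> card A = n - k"
      then have fin: "finite A" using finite_subset by blast
      have "\<bar>int (pattern_of \<sigma> A (i + 1)) - int (pattern_of \<sigma> A i)\<bar> > 1" if "i \<in> {1..<n - k}" for i
      proof (rule ccontr)
        let ?p = "nth_pos A i" and ?q = "nth_pos A (i + 1)"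
        assume "\<not> ?thesis"
        then have "between n \<sigma> ?p ?q \<inter> A = {}"
          using pattern_close_iff[OF \<sigma>, of A i "i + 1"] A that by simp
        moreover have "between n \<sigma> ?p ?q \<subseteq> {1..n}"
          unfolding between_points_def by (rule Collect_restrict)
        ultimately have "card (between n \<sigma> ?p ?q) \<le> card ({1..n} - A)"
          by (intro card_mono finite_Diff finite_atLeastAtMost) blast
        moreover have "card ({1..n} - A) = card {1..n} - card A"
          using A by (intro card_Diff_subset[OF fin]) blast
        ultimately have few: "\<not> k < card (between n \<sigma> ?p ?q)" using conjunct2[OF A] m by simp
        have "?p \<in> A" "?q \<in> A" using bij_betwE[OF bij_betw_nth_pos[OF fin]] that A by simp_all
        then have mem: "?p \<in> {1..n}" "?q \<in> {1..n}" using A by blast+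
        have "?p < ?q" using nth_pos_less_iff[OF fin, of i "i + 1"] that A by simp
        then have "?p \<noteq> ?q" by (rule less_imp_neq)
        from large[OF mem this] few show False by contradiction
      qed
      then show "pattern_of \<sigma> A \<in> kings (n - k)" using pattern[of A] A by (simp add: kings_def)
    next
      fix A B
      assume AB: "A \<subseteq> {1..n} \<and> card A = n - k \<and> B \<subseteq> {1..n} \<and> card B = n - k \<and> A \<noteq> B"
      have "n - (n - k) = k" using assms by simp
      then show "pattern_of \<sigma> A \<noteq> pattern_of \<sigma> B"
        using equal_patterns_imp_equal[OF \<sigma>, of A B] AB large by auto
    qed
  qed
qed

end
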